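(* Let $N>2$, $\alpha_0>0$ and $\alpha_\mu<0$ for $0<\mu<N$. For every lowest energy configuration, described by difference angles $(\psi_1,\dots,\psi_{N-1})$ with $\Psi=\sum_{\mu=1}^{N-1}\psi_\mu$, one has $$\alpha_0\sin\Psi=|\alpha_\mu|\sin\psi_\mu\qquad\text{for all }0<\mu<N,$$ i.e. the quantity $\beta:=\alpha_0\sin\Psi=|\alpha_\mu|\sin\psi_\mu$ is independent of $\mu$ for $0<\mu<N$.
   Context: Consider unit vectors $\mathbf{s}_0,\dots,\mathbf{s}_{N-1}\in\mathbb{R}^3$ (indices modulo $N$) with energy $E=\sum_{\mu=0}^{N-1}\alpha_\mu\,\mathbf{s}_\mu\cdot\mathbf{s}_{\mu+1}$. A lowest energy configuration (LEC) is a global minimizer of $E$. Every LEC lies in a two-dimensional subspace, so one can write $\mathbf{s}_\mu=(\cos\phi_\mu,\sin\phi_\mu)$; the difference angle $\psi_\mu\in(-\pi,\pi]$ is the representative of $\phi_{\mu+1}-\phi_\mu$ modulo $2\pi$. With $\Psi:=\sum_{\mu=1}^{N-1}\psi_\mu$ (so $\psi_0\equiv-\Psi$ mod $2\pi$), the energy is $E(\psi_1,\dots,\psi_{N-1})=\alpha_0\cos\Psi-\sum_{\mu=1}^{N-1}|\alpha_\mu|\cos\psi_\mu$, and an LEC corresponds to a global minimizer of this function. *)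

theory Defs
  imports "HOL-Analysis.Analysis" "HOL-Library.Real_Mod"
begin

text \<open>Only the values of a configuration at the sites \<open>0, \<dots>, N - 1\<close> matter.\<close>

definition spin_configuration :: "nat \<Rightarrow> (nat \<Rightarrow> real ^ 3) \<Rightarrow> bool" where
  "spin_configuration N s \<longleftrightarrow> (\<forall>\<mu><N. norm (s \<mu>) = 1)"

definition ring_energy :: "nat \<Rightarrow> (nat \<Rightarrow> real) \<Rightarrow> (nat \<Rightarrow> real ^ 3) \<Rightarrow> real" where
  "ring_energy N \<alpha> s = (\<Sum>\<mu><N. \<alpha> \<mu> * (s \<mu> \<bullet> s ((\<mu> + 1) mod N)))"

definition lowest_energy_configuration ::
    "nat \<Rightarrow> (nat \<Rightarrow> real) \<Rightarrow> (nat \<Rightarrow> real ^ 3) \<Rightarrow> bool" where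
  "lowest_energy_configuration N \<alpha> s \<longleftrightarrow>
     spin_configuration N s \<and>
     (\<forall>t. spin_configuration N t \<longrightarrow> ring_energy N \<alpha> s \<le> ring_energy N \<alpha> t)"

text \<open>The angles \<open>\<psi> 1, \<dots>, \<psi> (N - 1)\<close> describe \<open>s\<close>: with respect to an orthonormal basis
  \<open>u, v\<close> of some plane through the origin, \<open>s \<mu> = (cos (\<phi> \<mu>), sin (\<phi> \<mu>))\<close>, and \<open>\<psi> \<mu>\<close> is the
  representative of \<open>\<phi> (\<mu> + 1) - \<phi> \<mu>\<close> in the interval from \<open>-\<pi>\<close> (excluded) to \<open>\<pi>\<close>.
  The choice of \<open>u\<close>, \<open>v\<close>, \<open>\<phi>\<close> is not unique (reversing the orientation of the plane, for
  instance, essentially negates the angles), so this is a relation between \<open>s\<close> and \<open>\<psi>\<close>.\<close>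

definition difference_angles :: "nat \<Rightarrow> (nat \<Rightarrow> real ^ 3) \<Rightarrow> (nat \<Rightarrow> real) \<Rightarrow> bool" where
  "difference_angles N s \<psi> \<longleftrightarrow>
     (\<exists>u v \<phi>. norm u = 1 \<and> norm v = 1 \<and> u \<bullet> v = 0 \<and>
        (\<forall>\<mu><N. s \<mu> = cos (\<phi> \<mu>) *\<^sub>R u + sin (\<phi> \<mu>) *\<^sub>R v) \<and>
        (\<forall>\<mu>\<in>{1..<N}. \<psi> \<mu> \<in> {-pi<..pi} \<and>
           [\<psi> \<mu> = \<phi> ((\<mu> + 1) mod N) - \<phi> \<mu>] (rmod (2 * pi))))"

text \<open>Every lowest energy configuration is planar and hence has such a description: the
  minimality in the single spin \<open>s \<mu>\<close> makes \<open>s (\<mu> + 1)\<close> a linear combination of \<open>s \<mu>\<close> and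
  \<open>s (\<mu> - 1)\<close>.\<close>

lemma lowest_energy_local_field:
  assumes lec: "lowest_energy_configuration N \<alpha> s" and \<mu>: "0 < \<mu>" "\<mu> + 1 < N"
  obtains c where "\<alpha> \<mu> *\<^sub>R s (\<mu> + 1) + \<alpha> (\<mu> - 1) *\<^sub>R s (\<mu> - 1) = c *\<^sub>R s \<mu>"
proof -
  define h where "h = \<alpha> \<mu> *\<^sub>R s (\<mu> + 1) + \<alpha> (\<mu> - 1) *\<^sub>R s (\<mu> - 1)"
  have ns: "norm (s \<mu>) = 1"
    using lec \<mu> by (simp add: lowest_energy_configuration_def spin_configuration_def)
  have min: "h \<bullet> s \<mu> \<le> h \<bullet> v" if v: "norm v = 1" for v
  proof -
    let ?t = "s(\<mu> := v)"
    have "spin_configuration N ?t"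
      using lec v by (simp add: lowest_energy_configuration_def spin_configuration_def)
    then have le: "ring_energy N \<alpha> s \<le> ring_energy N \<alpha> ?t"
      using lec by (simp add: lowest_energy_configuration_def)
    have split: "ring_energy N \<alpha> f =
        (\<Sum>i\<in>{..<N} - {\<mu> - 1, \<mu>}. \<alpha> i * (f i \<bullet> f ((i + 1) mod N)))
        + \<alpha> (\<mu> - 1) * (f (\<mu> - 1) \<bullet> f \<mu>) + \<alpha> \<mu> * (f \<mu> \<bullet> f (\<mu> + 1))" for f
    proof -
      have "ring_energy N \<alpha> f =
        (\<Sum>i\<in>{..<N} - {\<mu> - 1, \<mu>}. \<alpha> i * (f i \<bullet> f ((i + 1) mod N)))
        + (\<Sum>i\<in>{\<mu> - 1, \<mu>}. \<alpha> i * (f i \<bullet> f ((i + 1) mod N)))"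
        unfolding ring_energy_def using \<mu> by (intro sum.subset_diff) auto
      then show ?thesis
        using \<mu> by simp
    qed
    have "(\<Sum>i\<in>{..<N} - {\<mu> - 1, \<mu>}. \<alpha> i * (?t i \<bullet> ?t ((i + 1) mod N)))
        = (\<Sum>i\<in>{..<N} - {\<mu> - 1, \<mu>}. \<alpha> i * (s i \<bullet> s ((i + 1) mod N)))"
    proof (intro sum.cong refl)
      fix i assume i: "i \<in> {..<N} - {\<mu> - 1, \<mu>}"
      have "(i + 1) mod N \<noteq> \<mu>"
        using i \<mu> by (cases "i + 1 = N") auto
      then show "\<alpha> i * (?t i \<bullet> ?t ((i + 1) mod N)) = \<alpha> i * (s i \<bullet> s ((i + 1) mod N))"
        using i by simp
    qed
    moreover have "\<mu> - 1 \<noteq> \<mu>"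
      using \<mu> by simp
    ultimately have "ring_energy N \<alpha> ?t - ring_energy N \<alpha> s = h \<bullet> v - h \<bullet> s \<mu>"
      using split[of s] split[of ?t] \<mu>
      by (simp add: h_def inner_add_left inner_add_right inner_commute)
    with le show ?thesis by simp
  qed
  have "h = (- norm h) *\<^sub>R s \<mu>"
  proof (cases "h = 0")
    case False
    have "h \<bullet> s \<mu> \<le> h \<bullet> (- (1 / norm h) *\<^sub>R h)"
      using False by (intro min) simp
    also have "\<dots> = - norm h"
      using False by (simp add: dot_square_norm power2_eq_square)
    finally have "h \<bullet> s \<mu> \<le> - norm h" .
    then have "norm h * (h \<bullet> s \<mu>) \<le> norm h * (- norm h)"
      by (intro mult_left_mono) auto
    moreover have "(norm (h + norm h *\<^sub>R s \<mu>))\<^sup>2 = 2 * (norm h)\<^sup>2 + 2 * (norm h * (h \<bullet> s \<mu>))"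
    proof -
      have "s \<mu> \<bullet> s \<mu> = 1"
        using ns by (simp add: norm_eq_1)
      then have "(h + norm h *\<^sub>R s \<mu>) \<bullet> (h + norm h *\<^sub>R s \<mu>)
          = h \<bullet> h + (norm h)\<^sup>2 + 2 * (norm h * (h \<bullet> s \<mu>))"
        by (simp add: inner_add_left inner_add_right inner_commute power2_eq_square)
      then show ?thesis
        by (simp add: dot_square_norm)
    qed
    ultimately have "(norm (h + norm h *\<^sub>R s \<mu>))\<^sup>2 \<le> 0"
      by (simp add: power2_eq_square)
    then show ?thesis
      by (simp add: eq_neg_iff_add_eq_0)
  qed simp
  then show thesis
    using that h_def by metis
qed

lemma lowest_energy_planar:
  assumes lec: "lowest_energy_configuration N \<alpha> s"
    and nz: "\<And>\<mu>. \<mu> < N \<Longrightarrow> \<alpha> \<mu> \<noteq> 0" and "\<mu> < N"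
  shows "s \<mu> \<in> span {s 0, s 1}"
  using \<open>\<mu> < N\<close>
proof (induction \<mu> rule: less_induct)
  case (less \<mu>)
  show ?case
  proof (cases "\<mu> \<le> 1")
    case True
    then have "\<mu> = 0 \<or> \<mu> = 1" by auto
    then show ?thesis by (auto intro: span_base)
  next
    case False
    define k where "k = \<mu> - 1"
    have k: "0 < k" "k + 1 < N" "\<mu> = k + 1"
      using False less.prems by (auto simp: k_def)
    obtain c where c: "\<alpha> k *\<^sub>R s (k + 1) + \<alpha> (k - 1) *\<^sub>R s (k - 1) = c *\<^sub>R s k"
      using lowest_energy_local_field[OF lec k(1,2)] .
    have "\<alpha> k *\<^sub>R s \<mu> = c *\<^sub>R s k - \<alpha> (k - 1) *\<^sub>R s (k - 1)"
      using c k by (simp add: algebra_simps)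
    moreover have "s k \<in> span {s 0, s 1}" "s (k - 1) \<in> span {s 0, s 1}"
      using less k by auto
    ultimately have "\<alpha> k *\<^sub>R s \<mu> \<in> span {s 0, s 1}"
      by (metis span_diff span_scale)
    then show ?thesis
      using nz[of k] k span_scale[of "\<alpha> k *\<^sub>R s \<mu>" _ "1 / \<alpha> k"] by simp
  qed
qed

lemma lowest_energy_difference_angles:
  assumes "lowest_energy_configuration N \<alpha> s" and "N > 2"
    and "\<And>\<mu>. \<mu> < N \<Longrightarrow> \<alpha> \<mu> \<noteq> 0"
  shows "\<exists>\<psi>. difference_angles N s \<psi>"
proof -
  have ns: "norm (s \<mu>) = 1" if "\<mu> < N" for \<mu>
    using assms that by (simp add: lowest_energy_configuration_def spin_configuration_def)
  define w where "w = s 1 - (s 0 \<bullet> s 1) *\<^sub>R s 0"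
  have n0: "norm (s 0) = 1" and d0: "s 0 \<bullet> s 0 = 1"
    using ns[of 0] assms by (auto simp: norm_eq_1)
  have ow: "s 0 \<bullet> w = 0"
    using d0 by (simp add: w_def inner_diff_right)
  obtain z where z: "z \<noteq> 0" "s 0 \<bullet> z = 0" "w \<in> span {z}"
  proof (cases "w = 0")
    case True
    obtain z where "z \<noteq> 0" "orthogonal (s 0) z"
      using orthogonal_to_vector_exists[of "s 0"] by (auto simp: orthogonal_commute)
    then show thesis
      using that[of z] True by (simp add: orthogonal_def span_0)
  next
    case False
    then show thesis
      using that[of w] ow by (simp add: span_base)
  qed
  define v where "v = (1 / norm z) *\<^sub>R z"
  have nv: "norm v = 1" and ov: "s 0 \<bullet> v = 0" and dv: "v \<bullet> v = 1"
    using z by (auto simp: v_def dot_square_norm power2_eq_square)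
  have zv: "z = norm z *\<^sub>R v"
    using z by (simp add: v_def)
  have "z \<in> span {s 0, v}"
    by (subst zv) (intro span_scale span_base, simp)
  then have "w \<in> span {s 0, v}"
    using z(3) by (metis empty_subsetI insert_subset span_minimal subsetD subspace_span)
  moreover have "s 1 = w + (s 0 \<bullet> s 1) *\<^sub>R s 0"
    by (simp add: w_def)
  ultimately have "s 1 \<in> span {s 0, v}"
    by (metis insertI1 span_add span_base span_scale)
  then have sp: "span {s 0, s 1} \<subseteq> span {s 0, v}"
    by (intro span_minimal) (auto intro: span_base)
  have "\<exists>a. s \<mu> = cos a *\<^sub>R s 0 + sin a *\<^sub>R v" if "\<mu> < N" for \<mu>
  proof -
    have "s \<mu> \<in> span {s 0, v}"
      using lowest_energy_planar[OF assms(1,3) that] sp by blast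
    then obtain a b where ab: "s \<mu> - a *\<^sub>R s 0 = b *\<^sub>R v"
      by (auto simp: span_insert span_singleton)
    then have e: "s \<mu> = a *\<^sub>R s 0 + b *\<^sub>R v"
      by (simp add: algebra_simps)
    have "s \<mu> \<bullet> s \<mu> = 1"
      using ns[OF that] by (simp add: norm_eq_1)
    then have "a\<^sup>2 + b\<^sup>2 = 1"
      unfolding e using d0 dv ov
      by (simp add: inner_add_left inner_add_right inner_commute power2_eq_square)
    then show ?thesis
      using sincos_total_2pi e by metis
  qed
  then obtain \<phi> where \<phi>: "\<And>\<mu>. \<mu> < N \<Longrightarrow> s \<mu> = cos (\<phi> \<mu>) *\<^sub>R s 0 + sin (\<phi> \<mu>) *\<^sub>R v"
    by metis
  define \<psi> where "\<psi> \<mu> = pi - (pi - (\<phi> ((\<mu> + 1) mod N) - \<phi> \<mu>)) rmod (2 * pi)" for \<mu>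
  have "\<psi> \<mu> \<in> {-pi<..pi}" for \<mu>
    using rmod_less[of "2 * pi"] rmod_nonneg[of "2 * pi"] by (simp add: \<psi>_def)
  moreover have "[\<psi> \<mu> = \<phi> ((\<mu> + 1) mod N) - \<phi> \<mu>] (rmod (2 * pi))" for \<mu>
  proof -
    have "[pi - (pi - (\<phi> ((\<mu> + 1) mod N) - \<phi> \<mu>)) rmod (2 * pi)
        = pi - (pi - (\<phi> ((\<mu> + 1) mod N) - \<phi> \<mu>))] (rmod (2 * pi))"
      by (intro rcong_intros)
    then show ?thesis by (simp add: \<psi>_def)
  qed
  ultimately have "difference_angles N s \<psi>"
    unfolding difference_angles_def using n0 nv ov \<phi>
    by (intro exI[of _ "s 0"] exI[of _ v] exI[of _ \<phi>]) blast
  then show ?thesis by blast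
qed

end

theory Submission
  imports Defs
begin

text \<open>Rotating the spins at the sites \<open>1, \<dots>, \<mu>\<close> rigidly within the plane changes only the bond
  angles at \<open>0\<close> and \<open>\<mu>\<close>, by opposite amounts. The energy is stationary along this rotation, which
  balances the two bonds.\<close>

lemma difference_angles_planar_form:
  assumes "difference_angles N s \<psi>"
  obtains u v \<phi> where "norm u = 1" "norm v = 1" "u \<bullet> v = 0"
    and "\<And>\<mu>. \<mu> < N \<Longrightarrow> s \<mu> = cos (\<phi> \<mu>) *\<^sub>R u + sin (\<phi> \<mu>) *\<^sub>R v"
    and "\<And>\<mu>. 1 \<le> \<mu> \<Longrightarrow> \<mu> < N \<Longrightarrow> [\<psi> \<mu> = \<phi> ((\<mu> + 1) mod N) - \<phi> \<mu>] (rmod (2 * pi))"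
  using assms unfolding difference_angles_def by (metis atLeastLessThan_iff)

text \<open>Turns each bond term into the cosine of an angle difference; with \<open>a = b\<close>
  it also shows that every planar vector of this form has norm 1.\<close>

lemma inner_planar:
  fixes u v :: "'a :: real_inner"
  assumes "norm u = 1" "norm v = 1" "u \<bullet> v = 0"
  shows "(cos a *\<^sub>R u + sin a *\<^sub>R v) \<bullet> (cos b *\<^sub>R u + sin b *\<^sub>R v) = cos (b - a)"
  using assms
  by (simp add: norm_eq_1 inner_add_left inner_add_right inner_commute cos_diff)

text \<open>Turning each spin within the plane at an arbitrary angular speed \<open>c \<nu>\<close>
  gives a curve of admissible configurations through \<open>s\<close>. The energy along it is
  minimal at 0, so its derivative vanishes there.\<close>

lemma lowest_energy_stationary:
  assumes lec: "lowest_energy_configuration N \<alpha> s"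
    and uv: "norm u = 1" "norm v = 1" "u \<bullet> v = 0"
    and s: "\<And>\<mu>. \<mu> < N \<Longrightarrow> s \<mu> = cos (\<phi> \<mu>) *\<^sub>R u + sin (\<phi> \<mu>) *\<^sub>R v"
  shows "(\<Sum>\<nu><N. \<alpha> \<nu> * sin (\<phi> ((\<nu> + 1) mod N) - \<phi> \<nu>) * (c ((\<nu> + 1) mod N) - c \<nu>)) = 0"
proof -
  define t where
    "t x \<nu> = cos (\<phi> \<nu> + x * c \<nu>) *\<^sub>R u + sin (\<phi> \<nu> + x * c \<nu>) *\<^sub>R v" for x \<nu>
  define E where "E x = (\<Sum>\<nu><N. \<alpha> \<nu> *
      cos (\<phi> ((\<nu> + 1) mod N) + x * c ((\<nu> + 1) mod N) - (\<phi> \<nu> + x * c \<nu>)))" for x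
  have E: "ring_energy N \<alpha> (t x) = E x" for x
    by (simp add: ring_energy_def E_def t_def inner_planar[OF uv])
  \<comment> \<open>\<open>s\<close> and \<open>t 0\<close> need not agree as functions, since
    \<open>\<phi>\<close> describes \<open>s\<close> only at sites below \<open>N\<close>; the
    energy reads no other sites.\<close>
  have "ring_energy N \<alpha> s = ring_energy N \<alpha> (t 0)"
    unfolding ring_energy_def by (intro sum.cong refl) (auto simp: s t_def)
  moreover have "spin_configuration N (t x)" for x
    using inner_planar[OF uv] by (simp add: spin_configuration_def t_def norm_eq_1)
  ultimately have min: "E 0 \<le> E x" for x
    using lec E by (metis lowest_energy_configuration_def)
  have "(E has_real_derivative
      (\<Sum>\<nu><N. - (\<alpha> \<nu> * sin (\<phi> ((\<nu> + 1) mod N) - \<phi> \<nu>) * (c ((\<nu> + 1) mod N) - c \<nu>)))) (at 0)"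
    unfolding E_def
    by (rule DERIV_sum) (auto intro!: derivative_eq_intros simp: algebra_simps)
  then have "(\<Sum>\<nu><N. - (\<alpha> \<nu> * sin (\<phi> ((\<nu> + 1) mod N) - \<phi> \<nu>) * (c ((\<nu> + 1) mod N) - c \<nu>))) = 0"
    using min by (intro DERIV_local_min[of E _ 0 1]) auto
  then show ?thesis
    by (simp add: sum_negf)
qed

lemma sin_eq_if_rcong:
  assumes "[x = y] (rmod (2 * pi))"
  shows "sin x = sin y"
  using assms by (metis rcong_def sin_rmod)

lemma rcong_sum:
  assumes "\<And>i. i \<in> A \<Longrightarrow> [f i = g i] (rmod m)"
  shows "[(\<Sum>i\<in>A. f i) = (\<Sum>i\<in>A. g i)] (rmod m)"
  using assms by (induction A rule: infinite_finite_induct) (auto intro: rcong_intros)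

text \<open>The sum telescopes along \<open>\<phi> (\<nu> mod N)\<close>, whose value at the upper
  end \<open>N\<close> wraps around to \<open>\<phi> 0\<close>.\<close>

lemma sum_cyclic_differences:
  fixes \<phi> :: "nat \<Rightarrow> 'a :: ab_group_add"
  assumes "N > 1"
  shows "(\<Sum>\<nu>\<in>{1..<N}. \<phi> ((\<nu> + 1) mod N) - \<phi> \<nu>) = \<phi> 0 - \<phi> 1"
proof -
  have "(\<Sum>\<nu>\<in>{1..<N}. \<phi> ((\<nu> + 1) mod N) - \<phi> \<nu>)
      = (\<Sum>\<nu>\<in>{1..<N}. \<phi> (Suc \<nu> mod N) - \<phi> (\<nu> mod N))"
    by (intro sum.cong) auto
  also have "\<dots> = \<phi> (N mod N) - \<phi> (1 mod N)"
    using assms by (intro sum_Suc_diff') auto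
  finally show ?thesis
    using assms by simp
qed

theorem proposition1:
  fixes N :: nat and \<alpha> :: "nat \<Rightarrow> real" and s :: "nat \<Rightarrow> real ^ 3" and \<psi> :: "nat \<Rightarrow> real"
  assumes "N > 2"
    and "\<alpha> 0 > 0"
    and "\<And>\<mu>. 0 < \<mu> \<Longrightarrow> \<mu> < N \<Longrightarrow> \<alpha> \<mu> < 0"
    and "lowest_energy_configuration N \<alpha> s"
    and "difference_angles N s \<psi>"
  shows "\<forall>\<mu>. 0 < \<mu> \<and> \<mu> < N \<longrightarrow>
    \<alpha> 0 * sin (\<Sum>\<nu>\<in>{1..<N}. \<psi> \<nu>) = \<bar>\<alpha> \<mu>\<bar> * sin (\<psi> \<mu>)"
proof (intro allI impI)
  fix \<mu> assume \<mu>: "0 < \<mu> \<and> \<mu> < N"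
  obtain u v \<phi> where uv: "norm u = 1" "norm v = 1" "u \<bullet> v = 0"
    and s: "\<And>\<mu>. \<mu> < N \<Longrightarrow> s \<mu> = cos (\<phi> \<mu>) *\<^sub>R u + sin (\<phi> \<mu>) *\<^sub>R v"
    and \<psi>: "\<And>\<mu>. 1 \<le> \<mu> \<Longrightarrow> \<mu> < N \<Longrightarrow> [\<psi> \<mu> = \<phi> ((\<mu> + 1) mod N) - \<phi> \<mu>] (rmod (2 * pi))"
    using difference_angles_planar_form[OF assms(5)] by metis
  \<comment> \<open>Unlike \<open>\<psi>\<close>, these unreduced differences also cover the bond at
    0.\<close>
  define \<delta> where "\<delta> \<nu> = \<phi> ((\<nu> + 1) mod N) - \<phi> \<nu>" for \<nu>
  define c :: "nat \<Rightarrow> real" where "c \<nu> = of_bool (\<nu> \<in> {1..\<mu>})" for \<nu>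
  \<comment> \<open>Only the two bonds at the ends of the rotated block change. If
    \<open>\<mu> = N - 1\<close>, the second one leads back to site 0, which stays fixed.\<close>
  have c: "c ((\<nu> + 1) mod N) - c \<nu> = of_bool (\<nu> = 0) - of_bool (\<nu> = \<mu>)" if "\<nu> < N" for \<nu>
    using that \<mu> by (cases "\<nu> + 1 = N") (auto simp: c_def)
  have "0 = (\<Sum>\<nu><N. \<alpha> \<nu> * sin (\<delta> \<nu>) * (c ((\<nu> + 1) mod N) - c \<nu>))"
    using lowest_energy_stationary[OF assms(4) uv s] by (simp add: \<delta>_def)
  also have "\<dots> = (\<Sum>\<nu><N. (if \<nu> = 0 then \<alpha> \<nu> * sin (\<delta> \<nu>) else 0)
      - (if \<nu> = \<mu> then \<alpha> \<nu> * sin (\<delta> \<nu>) else 0))"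
    using \<mu> by (intro sum.cong refl, subst c) auto
  also have "\<dots> = \<alpha> 0 * sin (\<delta> 0) - \<alpha> \<mu> * sin (\<delta> \<mu>)"
    using \<mu> by (simp add: sum_subtractf)
  finally have balance: "\<alpha> 0 * sin (\<delta> 0) = \<alpha> \<mu> * sin (\<delta> \<mu>)"
    by simp
  \<comment> \<open>The differences around the whole ring add up to 0, so those away from bond 0 sum
    to \<open>- \<delta> 0\<close>. Passing to \<open>\<psi>\<close> costs multiples of
    \<open>2 * pi\<close>, which the sine ignores.\<close>
  have "[(\<Sum>\<nu>\<in>{1..<N}. \<psi> \<nu>) = (\<Sum>\<nu>\<in>{1..<N}. \<phi> ((\<nu> + 1) mod N) - \<phi> \<nu>)] (rmod (2 * pi))"
    by (intro rcong_sum \<psi>) auto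
  also have "(\<Sum>\<nu>\<in>{1..<N}. \<phi> ((\<nu> + 1) mod N) - \<phi> \<nu>) = - \<delta> 0"
    using assms(1) by (subst sum_cyclic_differences) (auto simp: \<delta>_def)
  finally have "sin (\<Sum>\<nu>\<in>{1..<N}. \<psi> \<nu>) = - sin (\<delta> 0)"
    by (metis sin_eq_if_rcong sin_minus)
  moreover have "sin (\<psi> \<mu>) = sin (\<delta> \<mu>)"
    using \<psi> \<mu> by (simp add: sin_eq_if_rcong \<delta>_def)
  \<comment> \<open>This minus sign cancels the one in \<open>- sin (\<delta> 0)\<close>, turning
    \<open>balance\<close> into the claim.\<close>
  moreover have "\<bar>\<alpha> \<mu>\<bar> = - \<alpha> \<mu>"
    using assms(3) \<mu> by (simp add: abs_of_neg)
  ultimately show "\<alpha> 0 * sin (\<Sum>\<nu>\<in>{1..<N}. \<psi> \<nu>) = \<bar>\<alpha> \<mu>\<bar> * sin (\<psi> \<mu>)"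
    using balance by simp
qed

end
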